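(* Let $n,d\ge 1$ and $t\ge 0$ be integers with $n>3t$. For $n$ clients with vectors in $\mathbb{R}^d$, up to $t$ of which are Byzantine, one round of the Box algorithm, and likewise one round of the RB-TM algorithm, computes a $2\sqrt{\min\{n,d\}}$-approximation of the centroid.
   Context: Model. There are $n$ clients, up to $t<n/3$ of which are Byzantine, and one trusted server. The server receives a family of $m$ vectors $(v_i)_{i\in M}$ in $\mathbb{R}^d$ (Euclidean norm and distance $\mathrm{dist}$), where $M\subseteq\{1,\dots,n\}$, $|M|=m$, $n-t\le m\le n$. An unknown set $N\subseteq M$ with $|N|\ge n-t$ is the set of non-faulty clients; the vectors of the clients in $M\setminus N$ are Byzantine and arbitrary. An aggregation algorithm is a deterministic function of the received family only (it does not know $N$); its output is a vector in $\mathbb{R}^d$. A received family together with an admissible set $N$ is called a configuration. True centroid: $\mathrm{Cent}^\star=\frac1{|N|}\sum_{i\in N}v_i$. Candidate centroids: $S_{\mathrm{Cent}}$ is the set of all averages $\frac{1}{n-t}\sum_{i\in I}v_i$ with $I\subseteq M$, $|I|=n-t$. Let $\mathrm{Rad_{cov}}$ be the radius of the smallest closed Euclidean ball containing $S_{\mathrm{Cent}}$. Approximation: an algorithm computes an $\alpha$-approximation of the centroid if, in every configuration, its output $O$ satisfies $\mathrm{dist}(O,\mathrm{Cent}^\star)\le\alpha\cdot\mathrm{Rad_{cov}}$. Centroid hyperbox $\mathrm{CH}$: the smallest coordinate-parallel hyperbox containing $S_{\mathrm{Cent}}$. Trimmed trusted hyperbox $\mathrm{TTH}$: for each coordinate $k\in\{1,\dots,d\}$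 sort the $m$ received values $v_i[k]$ as $w^{(k)}_1\le\dots\le w^{(k)}_m$; then $\mathrm{TTH}=\prod_{k=1}^d\bigl[w^{(k)}_{m-(n-t)+1},\,w^{(k)}_{n-t}\bigr]$. Box algorithm (one round, run by the server): output the center (coordinate-wise midpoint) of the hyperbox $\mathrm{CH}\cap\mathrm{TTH}$, which is non-empty when $n>3t$. RB-TM algorithm (one round, run by the server): the coordinate-wise trimmed mean; in each coordinate $k$ the $m-(n-t)$ smallest and the $m-(n-t)$ largest received values are discarded and the output's $k$-th coordinate is the average of the remaining values $w^{(k)}_{m-(n-t)+1},\dots,w^{(k)}_{n-t}$. *)

theory Defs
  imports "HOL-Analysis.Analysis"
begin

text \<open>
  Clients are the numbers in \<open>{1..n}\<close>.  A received family is a partial map from clients to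
  vectors; its domain is the set $M$ of clients heard from.  An aggregation rule
  is thus a function of \<open>nat \<rightharpoonup> real^'d\<close> alone (for fixed \<open>n\<close> and \<open>t\<close>), so it cannot
  depend on the set $N$ of non-faulty clients.
\<close>

text \<open>
  The bound \<open>card (dom f) \<le> n\<close> follows from \<open>dom f \<subseteq> {1..n}\<close>.
\<close>

definition configuration :: "nat \<Rightarrow> nat \<Rightarrow> (nat \<rightharpoonup> real^'d) \<Rightarrow> nat set \<Rightarrow> bool" where
  "configuration n t f N \<longleftrightarrow>
     dom f \<subseteq> {1..n} \<and> n - t \<le> card (dom f) \<and> N \<subseteq> dom f \<and> n - t \<le> card N"

definition average :: "(nat \<rightharpoonup> real^'d) \<Rightarrow> nat set \<Rightarrow> real^'d" where
  "average f I = (1 / real (card I)) *\<^sub>R (\<Sum>i\<in>I. the (f i))"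

definition candidate_centroids :: "nat \<Rightarrow> nat \<Rightarrow> (nat \<rightharpoonup> real^'d) \<Rightarrow> (real^'d) set" where
  "candidate_centroids n t f = {average f I | I. I \<subseteq> dom f \<and> card I = n - t}"

text \<open>
  For a nonempty finite set the infimum below ranges over nonnegative radii only and is attained
  (lemma \<open>covering_radius_attained\<close>), so it is the radius of the smallest enclosing ball.
\<close>

definition covering_radius :: "(real^'d) set \<Rightarrow> real" where
  "covering_radius S = Inf {r. \<exists>c. S \<subseteq> cball c r}"

definition computes_approximation ::
    "nat \<Rightarrow> nat \<Rightarrow> real \<Rightarrow> ((nat \<rightharpoonup> real^'d) \<Rightarrow> real^'d) \<Rightarrow> bool" where
  "computes_approximation n t \<alpha> A \<longleftrightarrow>
     (\<forall>f N. configuration n t f N \<longrightarrow>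
        dist (A f) (average f N) \<le> \<alpha> * covering_radius (candidate_centroids n t f))"

definition is_hyperbox :: "(real^'d) set \<Rightarrow> bool" where
  "is_hyperbox B \<longleftrightarrow> (\<exists>a b. B = cbox a b)"

definition centroid_hyperbox :: "nat \<Rightarrow> nat \<Rightarrow> (nat \<rightharpoonup> real^'d) \<Rightarrow> (real^'d) set" where
  "centroid_hyperbox n t f = is_hyperbox hull candidate_centroids n t f"

text \<open>
  \<open>sorted_value f k j\<close> is the \<open>j\<close>-th smallest received value in coordinate \<open>k\<close>, counted with
  multiplicity and starting from \<open>j = 1\<close>.
\<close>

definition sorted_value :: "(nat \<rightharpoonup> real^'d) \<Rightarrow> 'd \<Rightarrow> nat \<Rightarrow> real" where
  "sorted_value f k j = sort (map (\<lambda>i. the (f i) $ k) (sorted_list_of_set (dom f))) ! (j - 1)"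

definition trimmed_trusted_hyperbox :: "nat \<Rightarrow> nat \<Rightarrow> (nat \<rightharpoonup> real^'d) \<Rightarrow> (real^'d) set" where
  "trimmed_trusted_hyperbox n t f =
     cbox (\<chi> k. sorted_value f k (card (dom f) - (n - t) + 1)) (\<chi> k. sorted_value f k (n - t))"

text \<open>
  The library's \<open>interval_lowerbound\<close> and \<open>interval_upperbound\<close> are the coordinate-wise infimum
  and supremum; on a nonempty \<open>cbox a b\<close> they are \<open>a\<close> and \<open>b\<close>.
\<close>

definition hyperbox_center :: "(real^'d) set \<Rightarrow> real^'d" where
  "hyperbox_center B = midpoint (interval_lowerbound B) (interval_upperbound B)"

definition box_algorithm :: "nat \<Rightarrow> nat \<Rightarrow> (nat \<rightharpoonup> real^'d) \<Rightarrow> real^'d" where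
  "box_algorithm n t f =
     hyperbox_center (centroid_hyperbox n t f \<inter> trimmed_trusted_hyperbox n t f)"

definition rb_tm_algorithm :: "nat \<Rightarrow> nat \<Rightarrow> (nat \<rightharpoonup> real^'d) \<Rightarrow> real^'d" where
  "rb_tm_algorithm n t f =
     (\<chi> k. let J = {card (dom f) - (n - t) + 1 .. n - t}
           in (\<Sum>j\<in>J. sorted_value f k j) / real (card J))"

lemma covering_radius_attained:
  fixes S :: "(real^'d) set"
  assumes "finite S" "S \<noteq> {}"
  shows "\<exists>c. S \<subseteq> cball c (covering_radius S)"
proof -
  let ?R = "{r. \<exists>c. S \<subseteq> cball c r}"
  let ?\<rho> = "covering_radius S"
  have "bounded S" using assms by (simp add: finite_imp_bounded)
  then have ne: "?R \<noteq> {}" by (auto simp: bounded_subset_cball bounded_def subset_iff)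
  have up: "r \<in> ?R \<Longrightarrow> r \<le> s \<Longrightarrow> s \<in> ?R" for r s
    using subset_cball by blast
  have F: "(\<Inter>x\<in>S. cball x r) \<noteq> {}" if "?\<rho> < r" for r
  proof -
    have "\<exists>q\<in>?R. q < r" using that cInf_lessD[OF ne] unfolding covering_radius_def by blast
    then have "r \<in> ?R" using up less_imp_le by blast
    then obtain c where "S \<subseteq> cball c r" by blast
    then have "c \<in> (\<Inter>x\<in>S. cball x r)" by (auto simp: dist_commute)
    then show ?thesis by blast
  qed
  define G where "G k = (\<Inter>x\<in>S. cball x (?\<rho> + 1 / real (Suc k)))" for k
  have "\<Inter> (range G) \<noteq> {}"
  proof (rule compact_nest)
    fix k
    show "G k \<noteq> {}" unfolding G_def by (rule F) simp
    show "compact (G k)" unfolding G_def using assms by (intro compact_Inter) auto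
  next
    fix k l :: nat assume "k \<le> l"
    then have "1 / real (Suc l) \<le> 1 / real (Suc k)" by (simp add: field_simps)
    then show "G l \<subseteq> G k" unfolding G_def by fastforce
  qed
  then obtain c where c: "\<And>k. c \<in> G k" by blast
  have "dist c x \<le> ?\<rho>" if "x \<in> S" for x
  proof (rule field_le_epsilon)
    fix e :: real assume "0 < e"
    then obtain k where "1 / real (Suc k) < e" using nat_approx_posE by blast
    moreover have "dist c x \<le> ?\<rho> + 1 / real (Suc k)"
      using c[of k] that by (auto simp: G_def dist_commute[of c x])
    ultimately show "dist c x \<le> ?\<rho> + e" by linarith
  qed
  then show ?thesis by (intro exI[of _ c]) auto
qed

lemma is_hyperbox_hull:
  fixes S :: "(real^'d) set"
  assumes "finite S" "S \<noteq> {}"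
  shows "is_hyperbox hull S = cbox (\<chi> k. Min ((\<lambda>x. x $ k) ` S)) (\<chi> k. Max ((\<lambda>x. x $ k) ` S))"
    (is "_ = ?B")
proof
  have "S \<subseteq> ?B" using assms by (auto simp: mem_box_cart)
  then show "is_hyperbox hull S \<subseteq> ?B"
    unfolding is_hyperbox_def by (intro hull_minimal) auto
  have "?B \<subseteq> cbox a b" if "S \<subseteq> cbox a b" for a b
  proof -
    have "a $ k \<le> Min ((\<lambda>x. x $ k) ` S)" "Max ((\<lambda>x. x $ k) ` S) \<le> b $ k" for k
      using assms that by (auto simp: mem_box_cart)
    then show ?thesis by (auto simp: mem_box_cart) (meson order_trans)+
  qed
  then show "?B \<subseteq> is_hyperbox hull S"
    unfolding hull_def is_hyperbox_def by blast
qed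

end

theory Submission
  imports Defs
begin

text \<open>
  Both outputs and the true centroid lie in the centroid hyperbox (the box whose center the Box
  algorithm outputs is nonempty because it contains the trimmed mean), so it suffices to bound the
  distance of two points of the centroid hyperbox.  Each of its coordinate intervals has length at
  most \<open>2 Rad\<close>, which gives the factor \<open>2 sqrt d\<close>.  For the factor \<open>2 sqrt n\<close>, let \<open>\<mu>\<close> be the mean of
  all \<open>m\<close> received vectors.  In each coordinate, the squared deviation of any candidate from \<open>\<mu>\<close> is
  at most \<open>m - 1\<close> times the mean squared deviation of all candidates from an arbitrary point
  (Cauchy-Schwarz against the variance of sampling without replacement).  Taking the centre of the
  smallest enclosing ball as that point and summing over the coordinates, every point of the
  centroid hyperbox is within \<open>sqrt (m - 1) Rad\<close> of \<open>\<mu>\<close>.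
\<close>

section \<open>Subsets of fixed size\<close>

lemma card_subsets_separating:
  assumes "finite M" "i \<in> M" "j \<in> M" "i \<noteq> j" "g \<ge> 1"
  shows "card {I. I \<subseteq> M \<and> card I = g \<and> i \<in> I \<and> j \<notin> I} = (card M - 2) choose (g - 1)"
proof -
  let ?S = "{I. I \<subseteq> M \<and> card I = g \<and> i \<in> I \<and> j \<notin> I}"
  let ?T = "{B. B \<subseteq> M - {i, j} \<and> card B = g - 1}"
  have "bij_betw (insert i) ?T ?S"
  proof (rule bij_betw_byWitness[where f' = "\<lambda>I. I - {i}"])
    show "insert i ` ?T \<subseteq> ?S"
    proof (intro subsetI; elim imageE)
      fix I B assume I: "I = insert i B" and B: "B \<in> ?T"
      then have "finite B" "i \<notin> B" using assms finite_subset by blast+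
      then show "I \<in> ?S" using I B assms by auto
    qed
    show "(\<lambda>I. I - {i}) ` ?S \<subseteq> ?T"
      using assms by (auto simp: card_Diff_singleton)
  qed auto
  then have "card ?S = card ?T" by (simp add: bij_betw_same_card)
  also have "\<dots> = card (M - {i, j}) choose (g - 1)"
    using assms by (intro n_subsets) auto
  also have "card (M - {i, j}) = card M - 2"
    using assms by (subst card_Diff_subset) auto
  finally show ?thesis .
qed

text \<open>Expand each product over pairs (i, j). Every pair of distinct elements is separated by
  the same number of subsets \<open>I\<close> and a diagonal pair by none, which leaves the product
  of the full sums minus its diagonal. The instances (u, u), (1, 1) and (u, 1) later give the second
  moment, the count and the first moment of subset sums.\<close>

lemma sum_subsets_prod_compl:
  fixes x y :: "'a \<Rightarrow> real"
  assumes "finite M" "g \<ge> 1"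
  shows "(\<Sum>I | I \<subseteq> M \<and> card I = g. sum x I * sum y (M - I)) =
    real ((card M - 2) choose (g - 1)) * (sum x M * sum y M - (\<Sum>i\<in>M. x i * y i))"
proof -
  let ?F = "{I. I \<subseteq> M \<and> card I = g}"
  let ?K = "real ((card M - 2) choose (g - 1))"
  have finF: "finite ?F" using assms by simp
  have "sum x I * sum y (M - I) =
      (\<Sum>i\<in>M. \<Sum>j\<in>M. x i * y j * of_bool (i \<in> I \<and> j \<notin> I))" if "I \<in> ?F" for I
  proof -
    have "sum x I = (\<Sum>i\<in>M. x i * of_bool (i \<in> I))"
      using that assms by (intro sum.mono_neutral_cong_left) auto
    moreover have "sum y (M - I) = (\<Sum>j\<in>M. y j * of_bool (j \<notin> I))"
      using that assms by (intro sum.mono_neutral_cong_left) auto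
    ultimately show ?thesis
      by (simp add: sum_product of_bool_conj mult_ac)
  qed
  then have "(\<Sum>I\<in>?F. sum x I * sum y (M - I)) =
      (\<Sum>I\<in>?F. \<Sum>i\<in>M. \<Sum>j\<in>M. x i * y j * of_bool (i \<in> I \<and> j \<notin> I))"
    by (intro sum.cong) auto
  also have "\<dots> = (\<Sum>i\<in>M. \<Sum>I\<in>?F. \<Sum>j\<in>M. x i * y j * of_bool (i \<in> I \<and> j \<notin> I))"
    by (rule sum.swap)
  also have "\<dots> = (\<Sum>i\<in>M. \<Sum>j\<in>M. \<Sum>I\<in>?F. x i * y j * of_bool (i \<in> I \<and> j \<notin> I))"
    by (intro sum.cong refl sum.swap)
  also have "\<dots> = (\<Sum>i\<in>M. \<Sum>j\<in>M. ?K * (x i * y j - (if j = i then x i * y j else 0)))"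
  proof (intro sum.cong refl)
    fix i j assume ij: "i \<in> M" "j \<in> M"
    have "(\<Sum>I\<in>?F. x i * y j * of_bool (i \<in> I \<and> j \<notin> I)) =
        x i * y j * real (card {I \<in> ?F. i \<in> I \<and> j \<notin> I})"
      using finF by (simp flip: sum_distrib_left add: sum.If_cases of_bool_def Int_def)
    also have "{I \<in> ?F. i \<in> I \<and> j \<notin> I} = {I. I \<subseteq> M \<and> card I = g \<and> i \<in> I \<and> j \<notin> I}"
      by auto
    also have "x i * y j * real (card \<dots>) =
        ?K * (x i * y j - (if j = i then x i * y j else 0))"
      using ij assms by (cases "i = j") (auto simp: card_subsets_separating)
    finally show "(\<Sum>I\<in>?F. x i * y j * of_bool (i \<in> I \<and> j \<notin> I)) =
        ?K * (x i * y j - (if j = i then x i * y j else 0))" .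
  qed
  also have "\<dots> = ?K * (sum x M * sum y M - (\<Sum>i\<in>M. x i * y i))"
    using assms by (simp flip: sum_distrib_left add: sum_subtractf sum_product)
  finally show ?thesis .
qed

text \<open>The sums over \<open>A\<close> and over its complement are opposite, so Cauchy-Schwarz
  bounds the same square from both parts. Weight each bound by the size of the other part and
  add.\<close>

lemma subset_sum_sq_le:
  fixes u :: "'a \<Rightarrow> real"
  assumes "finite M" "A \<subseteq> M" "sum u M = 0"
  shows "real (card M) * (sum u A)\<^sup>2 \<le>
    real (card A) * (real (card M) - real (card A)) * (\<Sum>i\<in>M. (u i)\<^sup>2)"
proof -
  let ?B = "M - A"
  have cardB: "real (card ?B) = real (card M) - real (card A)"
    using assms by (simp add: card_Diff_subset card_mono finite_subset of_nat_diff)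
  have uB: "sum u ?B = - sum u A" using assms by (simp add: sum_diff)
  have "(sum u A)\<^sup>2 \<le> (\<Sum>i\<in>A. (u i)\<^sup>2) * card A"
    by (rule sum_squared_le_sum_of_squares)
  then have 1: "card ?B * (sum u A)\<^sup>2 \<le> card ?B * ((\<Sum>i\<in>A. (u i)\<^sup>2) * card A)"
    by (intro mult_left_mono) auto
  have "(sum u ?B)\<^sup>2 \<le> (\<Sum>i\<in>?B. (u i)\<^sup>2) * card ?B"
    by (rule sum_squared_le_sum_of_squares)
  then have 2: "card A * (sum u A)\<^sup>2 \<le> card A * ((\<Sum>i\<in>?B. (u i)\<^sup>2) * card ?B)"
    unfolding uB by (intro mult_left_mono) auto
  have "(\<Sum>i\<in>M. (u i)\<^sup>2) = (\<Sum>i\<in>?B. (u i)\<^sup>2) + (\<Sum>i\<in>A. (u i)\<^sup>2)"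
    using assms by (intro sum.subset_diff)
  then show ?thesis using 1 2 unfolding cardB by (simp add: algebra_simps)
qed

text \<open>\<open>subset_sum_sq_le\<close> bounds one subset sum by the sum of squares of
  \<open>u\<close>, and the second moment of all subset sums is a multiple of that same sum of
  squares. The shift \<open>e\<close> is harmless because the subset sums average to zero, and
  squared deviations are smallest about the mean.\<close>

lemma subset_sum_sq_le_sum_subsets:
  fixes u :: "'a \<Rightarrow> real"
  assumes M: "finite M" and A: "A \<subseteq> M" "card A = g" "g \<ge> 1" and u: "sum u M = 0"
  shows "real (card M choose g) * (sum u A)\<^sup>2 \<le>
    (real (card M) - 1) * (\<Sum>I | I \<subseteq> M \<and> card I = g. (sum u I - e)\<^sup>2)"
proof -
  let ?F = "{I. I \<subseteq> M \<and> card I = g}"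
  let ?m = "real (card M)" and ?C = "real (card M choose g)"
  let ?K = "real ((card M - 2) choose (g - 1))"
  have cF: "real (card ?F) = ?C" using M by (simp add: n_subsets)
  have gm: "g \<le> card M" using A M card_mono by blast
  then have m1: "?m \<ge> 1" using A by linarith
  have compl: "real (card (M - I)) = ?m - g" if "I \<in> ?F" for I
    using that M gm finite_subset[of I M] by (simp add: card_Diff_subset of_nat_diff)
  \<comment> \<open>As \<open>u\<close> sums to zero, the sum over \<open>M - I\<close> is minus the
    sum over \<open>I\<close>, so the product identity becomes one for squares.\<close>
  have "(\<Sum>I\<in>?F. (sum u I)\<^sup>2) = - (\<Sum>I\<in>?F. sum u I * sum u (M - I))"
    using M u by (subst sum_negf[symmetric], intro sum.cong refl)
      (auto simp: sum_diff power2_eq_square)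
  then have sq: "(\<Sum>I\<in>?F. (sum u I)\<^sup>2) = ?K * (\<Sum>i\<in>M. (u i)\<^sup>2)"
    using sum_subsets_prod_compl[OF M A(3), of u u] u by (simp add: power2_eq_square)
  \<comment> \<open>Counting separated pairs relates the two binomials without dividing by
    \<open>?K\<close>, which vanishes when \<open>g = card M\<close> exceeds 1.\<close>
  have "(\<Sum>I\<in>?F. sum (\<lambda>_. 1) I * sum (\<lambda>_. 1) (M - I)) = (\<Sum>I\<in>?F. real g * (?m - g))"
    using compl by (intro sum.cong) auto
  then have cnt: "?C * (g * (?m - g)) = ?K * (?m * (?m - 1))"
    using sum_subsets_prod_compl[OF M A(3), of "\<lambda>_. 1" "\<lambda>_. 1"] cF by (simp add: algebra_simps)
  have sum0: "(\<Sum>I\<in>?F. sum u I) = 0"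
  \<comment> \<open>The product identity yields the sum only up to the factor \<open>?m - g\<close>,
    so the case where this factor is zero is separate.\<close>
  proof (cases "g = card M")
    case True
    then have "?F = {M}" using M by (auto dest: card_subset_eq)
    then show ?thesis using u by simp
  next
    case False
    have "(\<Sum>I\<in>?F. sum u I * sum (\<lambda>_. 1) (M - I)) = (\<Sum>I\<in>?F. sum u I * (?m - g))"
      using compl by (intro sum.cong) auto
    then have "(\<Sum>I\<in>?F. sum u I) * (?m - g) = 0"
      using sum_subsets_prod_compl[OF M A(3), of u "\<lambda>_. 1"] u by (simp add: sum_distrib_right)
    then show ?thesis using False by simp
  qed
  have "(\<Sum>I\<in>?F. (sum u I - e)\<^sup>2) =
      (\<Sum>I\<in>?F. (sum u I)\<^sup>2) - 2 * e * (\<Sum>I\<in>?F. sum u I) + card ?F * e\<^sup>2"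
    by (simp add: power2_diff sum.distrib sum_subtractf sum_distrib_left mult_ac)
  then have var: "(\<Sum>I\<in>?F. (sum u I)\<^sup>2) \<le> (\<Sum>I\<in>?F. (sum u I - e)\<^sup>2)"
    by (simp add: sum0)
  \<comment> \<open>Multiplying by \<open>?m\<close> brings in \<open>g * (?m - g)\<close>, which
    \<open>cnt\<close> trades for \<open>?K * (?m * (?m - 1))\<close>; then \<open>sq\<close>
    absorbs \<open>?K\<close>, and \<open>?m\<close> cancels.\<close>
  have "?m * (?C * (sum u A)\<^sup>2) = ?C * (?m * (sum u A)\<^sup>2)" by simp
  also have "\<dots> \<le> ?C * (g * (?m - g) * (\<Sum>i\<in>M. (u i)\<^sup>2))"
    using subset_sum_sq_le[OF M A(1) u] A(2) by (intro mult_left_mono) auto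
  also have "\<dots> = ?C * (g * (?m - g)) * (\<Sum>i\<in>M. (u i)\<^sup>2)" by (simp only: mult.assoc)
  also have "\<dots> = ?m * ((?m - 1) * (\<Sum>I\<in>?F. (sum u I)\<^sup>2))" unfolding cnt sq by simp
  finally have "?C * (sum u A)\<^sup>2 \<le> (?m - 1) * (\<Sum>I\<in>?F. (sum u I)\<^sup>2)"
    using m1 by simp
  also have "\<dots> \<le> (?m - 1) * (\<Sum>I\<in>?F. (sum u I - e)\<^sup>2)"
    using m1 var by (intro mult_left_mono) auto
  finally show ?thesis .
qed

section \<open>Means of lower and upper parts\<close>

definition mean :: "('a \<Rightarrow> real) \<Rightarrow> 'a set \<Rightarrow> real" where
  "mean x A = sum x A / real (card A)"

lemma sum_diff_mean:
  assumes "finite I" "I \<noteq> {}"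
  shows "(\<Sum>i\<in>I. x i - c) = real (card I) * (mean x I - c)"
  using assms by (simp add: mean_def sum_subtractf right_diff_distrib)

text \<open>Centring at the mean of \<open>M\<close> turns subset sums into \<open>g\<close> times
  deviations of means, and the square of \<open>g\<close> cancels. The right side stays a sum over
  all subsets, with the binomial on the left, so that the bound can be added over coordinates, with
  \<open>e\<close> running through the coordinates of one centre.\<close>

lemma mean_sq_le_sum_subsets:
  fixes x :: "'a \<Rightarrow> real"
  assumes M: "finite M" and A: "A \<subseteq> M" "card A = g" "g \<ge> 1"
  shows "real (card M choose g) * (mean x A - mean x M)\<^sup>2 \<le>
    (real (card M) - 1) * (\<Sum>I | I \<subseteq> M \<and> card I = g. (mean x I - e)\<^sup>2)"
proof -
  let ?\<mu> = "mean x M" and ?F = "{I. I \<subseteq> M \<and> card I = g}"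
  let ?u = "\<lambda>i. x i - ?\<mu>"
  have ne: "M \<noteq> {}" using A by auto
  have dev: "sum ?u I = g * (mean x I - ?\<mu>)" if "I \<in> ?F" for I
    using that A M by (subst sum_diff_mean) (auto dest: finite_subset)
  have "real (card M choose g) * (sum ?u A)\<^sup>2 \<le>
      (real (card M) - 1) * (\<Sum>I\<in>?F. (sum ?u I - g * (e - ?\<mu>))\<^sup>2)"
    using sum_diff_mean[OF M ne, of x ?\<mu>]
    by (intro subset_sum_sq_le_sum_subsets assms) simp
  also have "(\<Sum>I\<in>?F. (sum ?u I - g * (e - ?\<mu>))\<^sup>2) = (\<Sum>I\<in>?F. (real g)\<^sup>2 * (mean x I - e)\<^sup>2)"
    by (intro sum.cong refl, subst dev) (auto simp: algebra_simps simp flip: power_mult_distrib)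
  also have "\<dots> = (real g)\<^sup>2 * (\<Sum>I\<in>?F. (mean x I - e)\<^sup>2)" by (simp add: sum_distrib_left)
  finally have "(real g)\<^sup>2 * (real (card M choose g) * (mean x A - ?\<mu>)\<^sup>2) \<le>
      (real g)\<^sup>2 * ((real (card M) - 1) * (\<Sum>I\<in>?F. (mean x I - e)\<^sup>2))"
    using dev[of A] A by (simp add: power_mult_distrib mult_ac)
  then show ?thesis using A by simp
qed

text \<open>The mean of the union is a weighted average of the two partial means. Summing the
  comparison over all pairs orders these without division, hence also when one part is
  empty.\<close>

lemma mean_Un_bounds:
  assumes "finite P" "finite Q" "P \<inter> Q = {}" and le: "\<And>p q. p \<in> P \<Longrightarrow> q \<in> Q \<Longrightarrow> x p \<le> x q"
  shows "P \<noteq> {} \<Longrightarrow> mean x P \<le> mean x (P \<union> Q)" "Q \<noteq> {} \<Longrightarrow> mean x (P \<union> Q) \<le> mean x Q"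
proof -
  have "(\<Sum>p\<in>P. \<Sum>q\<in>Q. x p) \<le> (\<Sum>p\<in>P. \<Sum>q\<in>Q. x q)"
    using le by (intro sum_mono)
  then have "card Q * sum x P \<le> card P * sum x Q"
    by (simp add: sum_distrib_left)
  moreover have "card (P \<union> Q) = card P + card Q" "sum x (P \<union> Q) = sum x P + sum x Q"
    using assms by (simp_all add: card_Un_disjoint sum.union_disjoint)
  moreover have "P \<noteq> {} \<Longrightarrow> card P > 0" "Q \<noteq> {} \<Longrightarrow> card Q > 0"
    using assms by (simp_all add: card_gt_0_iff)
  ultimately show "P \<noteq> {} \<Longrightarrow> mean x P \<le> mean x (P \<union> Q)" "Q \<noteq> {} \<Longrightarrow> mean x (P \<union> Q) \<le> mean x Q"
    by (auto simp: mean_def field_simps)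
qed

text \<open>\<open>N\<close> may have more than \<open>g\<close> elements, so its average need not
  be a candidate centroid. The \<open>g\<close> smallest values have mean at most the overall mean;
  negating \<open>x\<close> gives the other direction.\<close>

lemma mean_bounded_by_subsets:
  fixes x :: "'a \<Rightarrow> real"
  assumes N: "finite N" and g: "g \<ge> 1" "g \<le> card N"
  shows "\<exists>I\<subseteq>N. card I = g \<and> mean x I \<le> mean x N"
    and "\<exists>I\<subseteq>N. card I = g \<and> mean x N \<le> mean x I"
proof -
  have *: "\<exists>I\<subseteq>N. card I = g \<and> mean y I \<le> mean y N" for y :: "'a \<Rightarrow> real"
  proof -
    obtain xs where xs: "set xs = N" "distinct xs" using N finite_distinct_list by blast
    \<comment> \<open>Sorting the indices rather than the values makes a prefix a subset of
      \<open>N\<close> of known size, even with ties.\<close>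
    define L where "L = sort_key y xs"
    have L: "set L = N" "distinct L" "sorted (map y L)"
      using xs by (simp_all add: L_def)
    have len: "length L = card N" using L distinct_card by metis
    have split: "L = take g L @ drop g L" by simp
    have disj: "set (take g L) \<inter> set (drop g L) = {}"
      using L(2) split by (metis distinct_append)
    have "set (take g L) \<union> set (drop g L) = N"
      using L(1) split by (metis set_append)
    moreover have le: "y p \<le> y q" if "p \<in> set (take g L)" "q \<in> set (drop g L)" for p q
    proof -
      have "sorted (map y (take g L) @ map y (drop g L))"
        using L(3) by (simp flip: map_append)
      then show ?thesis using that by (simp add: sorted_append)
    qed
    moreover have cd: "card (set (take g L)) = g"
      using L len g by (simp add: distinct_card)
    ultimately show ?thesis
      using mean_Un_bounds(1)[OF _ _ disj le] g by (intro exI[of _ "set (take g L)"]) force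
  qed
  show "\<exists>I\<subseteq>N. card I = g \<and> mean x I \<le> mean x N" by (rule *)
  show "\<exists>I\<subseteq>N. card I = g \<and> mean x N \<le> mean x I"
    using *[of "\<lambda>i. - x i"] by (simp add: mean_def sum_negf)
qed

text \<open>Cut the sorted indices into the \<open>s\<close> smallest \<open>A\<close>, the kept
  block \<open>B\<close> and the \<open>s\<close> largest \<open>C\<close>. Since
  \<open>s + g = length xs\<close>, both \<open>A\<close> with \<open>B\<close> and \<open>B\<close>
  with \<open>C\<close> have exactly \<open>g\<close> elements, and their means bracket the mean of
  \<open>B\<close>, which is the trimmed mean.\<close>

lemma trimmed_mean_bounds:
  fixes x :: "'a \<Rightarrow> real"
  assumes xs: "distinct xs" "set xs = M"
    and s: "s + g = length xs" "s < g"
    and w_def: "w = sort (map x xs)"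
    and t_def: "t = (\<Sum>j\<in>{s+1..g}. w ! (j - 1)) / real (card {s+1..g})"
  shows "\<exists>I\<subseteq>M. card I = g \<and> mean x I \<le> t" "\<exists>I\<subseteq>M. card I = g \<and> t \<le> mean x I"
    and "w ! s \<le> t" "t \<le> w ! (g - 1)"
proof -
  define L where "L = sort_key x xs"
  have L: "set L = M" "distinct L" "sorted (map x L)" "length L = s + g"
    using xs s by (simp_all add: L_def)
  have w: "w = map x L"
    unfolding w_def L_def by (intro properties_for_sort) simp_all
  define A B C where "A = take s L" and "B = drop s (take g L)" and "C = drop g L"
  have split: "L = A @ B @ C"
    using s append_take_drop_id[of s "take g L"] append_take_drop_id[of g L]
    by (simp add: A_def B_def C_def min_def flip: append_assoc)
  have M: "M = set A \<union> set B \<union> set C"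
    using L(1) unfolding split by auto
  have dist: "distinct (A @ B @ C)" and srt: "sorted (map x (A @ B @ C))"
    using L(2,3) unfolding split by (simp_all only:)
  have len: "length A = s" "length B = g - s" "length C = s"
    using L(4) s by (simp_all add: A_def B_def C_def)
  have cardB: "card (set B) = g - s" using dist len by (simp add: distinct_card)
  then have Bne: "set B \<noteq> {}" using s by auto
  \<comment> \<open>Ranks count from 1 and list positions from 0, so rank \<open>j\<close> sits at
    position \<open>j - s - 1\<close> of \<open>B\<close>.\<close>
  have "(\<Sum>j\<in>{s+1..g}. w ! (j - 1)) = (\<Sum>i<g-s. x (B ! i))"
    using s L(4) unfolding w B_def
    by (intro sum.reindex_bij_witness[of _ "\<lambda>i. i + s + 1" "\<lambda>j. j - s - 1"]) (auto simp: add_ac)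
  also have "\<dots> = sum x (set B)"
    using dist len by (simp add: sum.distinct_set_conv_list sum_list_sum_nth atLeast0LessThan)
  finally have t: "t = mean x (set B)" using cardB by (simp add: t_def mean_def)
  have "mean x (set A \<union> set B) \<le> t" unfolding t
    using dist srt Bne by (intro mean_Un_bounds(2)) (auto simp: sorted_append)
  moreover have "card (set A \<union> set B) = g"
    using dist len s by (subst card_Un_disjoint) (auto simp: distinct_card)
  ultimately show "\<exists>I\<subseteq>M. card I = g \<and> mean x I \<le> t"
    using M by (intro exI[of _ "set A \<union> set B"]) auto
  have "t \<le> mean x (set B \<union> set C)" unfolding t
    using dist srt Bne by (intro mean_Un_bounds(1)) (auto simp: sorted_append)
  moreover have "card (set B \<union> set C) = g"
    using dist len s by (subst card_Un_disjoint) (auto simp: distinct_card)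
  ultimately show "\<exists>I\<subseteq>M. card I = g \<and> t \<le> mean x I"
    using M by (intro exI[of _ "set B \<union> set C"]) auto
  have "sorted w" "length w = s + g" using s by (simp_all add: w_def)
  then have b: "w ! s \<le> w ! (j - 1)" "w ! (j - 1) \<le> w ! (g - 1)" if "j \<in> {s+1..g}" for j
    using that s by (auto intro!: sorted_nth_mono)
  have c: "real (card {s+1..g}) > 0" using s by simp
  have "(\<Sum>j\<in>{s+1..g}. w ! s) \<le> (\<Sum>j\<in>{s+1..g}. w ! (j - 1))" by (intro sum_mono b)
  then show "w ! s \<le> t" unfolding t_def using c by (simp add: field_simps)
  have "(\<Sum>j\<in>{s+1..g}. w ! (j - 1)) \<le> (\<Sum>j\<in>{s+1..g}. w ! (g - 1))" by (intro sum_mono b)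
  then show "t \<le> w ! (g - 1)" unfolding t_def using c by (simp add: field_simps)
qed

section \<open>The centroid hyperbox\<close>

lemma average_nth: "average f I $ k = mean (\<lambda>i. the (f i) $ k) I"
  by (simp add: average_def mean_def)

lemma candidate_centroids_image:
  "candidate_centroids n t f = average f ` {I. I \<subseteq> dom f \<and> card I = n - t}"
  by (auto simp: candidate_centroids_def)

lemma candidate_centroids_nonempty:
  assumes "n - t \<le> card (dom f)"
  shows "candidate_centroids n t f \<noteq> {}"
proof -
  obtain I where "I \<subseteq> dom f" "card I = n - t"
    using obtain_subset_with_card_n[OF assms] by metis
  then show ?thesis by (auto simp: candidate_centroids_def)
qed

text \<open>A box constrains each coordinate separately, so the witnessing subsets may change with
  \<open>k\<close>. This reduces membership to the scalar statements about means.\<close>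

lemma mem_centroid_hyperbox_iff:
  fixes f :: "nat \<rightharpoonup> real^'d"
  assumes "finite (dom f)" "n - t \<le> card (dom f)"
  shows "y \<in> centroid_hyperbox n t f \<longleftrightarrow>
    (\<forall>k. (\<exists>I\<subseteq>dom f. card I = n - t \<and> mean (\<lambda>i. the (f i) $ k) I \<le> y $ k) \<and>
         (\<exists>I\<subseteq>dom f. card I = n - t \<and> y $ k \<le> mean (\<lambda>i. the (f i) $ k) I))"
proof -
  have fin: "finite (candidate_centroids n t f)"
    using assms by (simp add: candidate_centroids_image)
  have ne: "candidate_centroids n t f \<noteq> {}" by (intro candidate_centroids_nonempty assms)
  show ?thesis
    unfolding centroid_hyperbox_def is_hyperbox_hull[OF fin ne] mem_box_cart
    using fin ne by (simp add: Min_le_iff Max_ge_iff candidate_centroids_image average_nth Bex_def conj_assoc)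
qed

lemma centroid_hyperbox_cbox:
  fixes f :: "nat \<rightharpoonup> real^'d"
  assumes "finite (dom f)" "n - t \<le> card (dom f)"
  shows "\<exists>a b. centroid_hyperbox n t f = cbox a b"
proof -
  have "finite (candidate_centroids n t f)"
    using assms by (simp add: candidate_centroids_image)
  then show ?thesis
    using is_hyperbox_hull candidate_centroids_nonempty[OF assms(2)]
    unfolding centroid_hyperbox_def by blast
qed

lemma dist_centroid_hyperbox_le:
  fixes f :: "nat \<rightharpoonup> real^'d"
  assumes fin: "finite (dom f)" and g: "n - t \<le> card (dom f)" "n - t \<ge> 1"
    and card: "card (dom f) \<le> n"
    and y: "y \<in> centroid_hyperbox n t f" and z: "z \<in> centroid_hyperbox n t f"
  shows "dist y z \<le> 2 * sqrt (real (min n CARD('d))) * covering_radius (candidate_centroids n t f)"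
proof -
  let ?S = "candidate_centroids n t f" and ?F = "{I. I \<subseteq> dom f \<and> card I = n - t}"
  let ?x = "\<lambda>k i. the (f i) $ k"
  let ?m = "real (card (dom f))" and ?C = "real (card (dom f) choose (n - t))"
  define R where "R = covering_radius ?S"
  define \<mu> where "\<mu> = average f (dom f)"
  have "finite ?S" "?S \<noteq> {}"
    using fin g candidate_centroids_nonempty by (auto simp: candidate_centroids_image)
  then obtain c where "?S \<subseteq> cball c R"
    using covering_radius_attained unfolding R_def by blast
  then have ball: "dist c (average f I) \<le> R" if "I \<in> ?F" for I
    using that by (simp add: candidate_centroids_image image_subset_iff)
  obtain I0 where "I0 \<in> ?F"
    using \<open>?S \<noteq> {}\<close> by (auto simp: candidate_centroids_image)
  then have R0: "R \<ge> 0" using order_trans[OF zero_le_dist ball] by blast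
  have mean_near: "\<bar>mean (?x k) I - c $ k\<bar> \<le> R" if "I \<in> ?F" for k I
  proof -
    have "\<bar>mean (?x k) I - c $ k\<bar> = \<bar>(average f I - c) $ k\<bar>" by (simp add: average_nth)
    also have "\<dots> \<le> norm (average f I - c)" by (rule component_le_norm_cart)
    finally show ?thesis using ball[OF that] by (simp add: dist_norm norm_minus_commute)
  qed
  have near: "\<bar>p $ k - c $ k\<bar> \<le> R" if p: "p \<in> centroid_hyperbox n t f" for p k
  proof -
    obtain I J where "I \<in> ?F" "mean (?x k) I \<le> p $ k" "J \<in> ?F" "p $ k \<le> mean (?x k) J"
      using p unfolding mem_centroid_hyperbox_iff[OF fin g(1)] by blast
    then show ?thesis using mean_near[of I k] mean_near[of J k] by linarith
  qed
  have dim: "dist y z \<le> 2 * sqrt (real CARD('d)) * R"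
  proof (rule power2_le_imp_le)
    have "(y $ k - z $ k)\<^sup>2 \<le> (2 * R)\<^sup>2" for k
      using near[OF y, of k] near[OF z, of k] by (intro power2_le_iff_abs_le[THEN iffD2]) auto
    then have "(\<Sum>k\<in>UNIV. (y $ k - z $ k)\<^sup>2) \<le> (\<Sum>k\<in>(UNIV::'d set). (2 * R)\<^sup>2)"
      by (intro sum_mono)
    then show "(dist y z)\<^sup>2 \<le> (2 * sqrt (real CARD('d)) * R)\<^sup>2"
      by (simp add: dist_vec_def L2_set_def dist_real_def sum_nonneg power_mult_distrib)
  qed (use R0 in auto)
  have spread: "dist p \<mu> \<le> sqrt (real n) * R" if p: "p \<in> centroid_hyperbox n t f" for p
  proof (rule power2_le_imp_le)
    let ?V = "\<lambda>k. \<Sum>I\<in>?F. (mean (?x k) I - c $ k)\<^sup>2"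
    have C0: "?C > 0" using g by simp
    have m1: "?m \<ge> 1" using g by linarith
    have "?C * (p $ k - \<mu> $ k)\<^sup>2 \<le> (?m - 1) * ?V k" for k
    proof -
      obtain I J where I: "I \<in> ?F" "mean (?x k) I \<le> p $ k" and J: "J \<in> ?F" "p $ k \<le> mean (?x k) J"
        using p unfolding mem_centroid_hyperbox_iff[OF fin g(1)] by blast
      have A: "?C * (mean (?x k) A - \<mu> $ k)\<^sup>2 \<le> (?m - 1) * ?V k" if "A \<in> ?F" for A
        using that fin g unfolding \<mu>_def average_nth by (intro mean_sq_le_sum_subsets) auto
      \<comment> \<open>A number between two others deviates from any point at most as much as one
        of the two, so a candidate mean can replace \<open>p $ k\<close>.\<close>
      have "\<bar>p $ k - \<mu> $ k\<bar> \<le> \<bar>mean (?x k) I - \<mu> $ k\<bar> \<or> \<bar>p $ k - \<mu> $ k\<bar> \<le> \<bar>mean (?x k) J - \<mu> $ k\<bar>"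
        using I(2) J(2) by linarith
      then have "\<exists>A\<in>?F. (p $ k - \<mu> $ k)\<^sup>2 \<le> (mean (?x k) A - \<mu> $ k)\<^sup>2"
        using I(1) J(1) by (auto simp flip: abs_le_square_iff)
      then obtain A where "A \<in> ?F" "(p $ k - \<mu> $ k)\<^sup>2 \<le> (mean (?x k) A - \<mu> $ k)\<^sup>2" by blast
      then have "?C * (p $ k - \<mu> $ k)\<^sup>2 \<le> ?C * (mean (?x k) A - \<mu> $ k)\<^sup>2"
        using C0 by (intro mult_left_mono) auto
      then show ?thesis using A[OF \<open>A \<in> ?F\<close>] by linarith
    qed
    then have "(\<Sum>k\<in>UNIV. ?C * (p $ k - \<mu> $ k)\<^sup>2) \<le> (\<Sum>k\<in>UNIV. (?m - 1) * ?V k)"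
      by (intro sum_mono)
    then have "?C * (dist p \<mu>)\<^sup>2 \<le> (?m - 1) * (\<Sum>k\<in>UNIV. ?V k)"
      by (simp add: dist_vec_def L2_set_def dist_real_def sum_nonneg sum_distrib_left)
    \<comment> \<open>After the swap, the coordinates of each candidate assemble into its Euclidean
      distance to \<open>c\<close>, so the ball bound \<open>R\<close> is used once per candidate
      and no factor of the dimension appears.\<close>
    also have "(\<Sum>k\<in>UNIV. ?V k) = (\<Sum>I\<in>?F. \<Sum>k\<in>UNIV. (mean (?x k) I - c $ k)\<^sup>2)"
      by (rule sum.swap)
    also have "\<dots> = (\<Sum>I\<in>?F. (dist (average f I) c)\<^sup>2)"
      by (simp add: dist_vec_def L2_set_def dist_real_def sum_nonneg average_nth)
    also have "(?m - 1) * \<dots> \<le> (?m - 1) * (\<Sum>I\<in>?F. R\<^sup>2)"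
      using m1 ball by (intro mult_left_mono sum_mono power_mono) (auto simp: dist_commute)
    also have "\<dots> = ?C * ((?m - 1) * R\<^sup>2)"
      using fin by (simp add: n_subsets)
    finally have "(dist p \<mu>)\<^sup>2 \<le> (?m - 1) * R\<^sup>2" using C0 by simp
    also have "\<dots> \<le> real n * R\<^sup>2" using card by (intro mult_right_mono) auto
    finally show "(dist p \<mu>)\<^sup>2 \<le> (sqrt (real n) * R)\<^sup>2" by (simp add: power_mult_distrib)
  qed (use R0 in auto)
  \<comment> \<open>The factor 2 is the triangle inequality through \<open>\<mu>\<close>.\<close>
  have "dist y z \<le> 2 * sqrt (real n) * R"
    using spread[OF y] spread[OF z] dist_triangle2[of y z \<mu>] by linarith
  then show ?thesis using dim unfolding R_def by (cases "n \<le> CARD('d)") (simp_all add: min_def)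
qed

section \<open>The two algorithms\<close>

lemma average_mem_centroid_hyperbox:
  fixes f :: "nat \<rightharpoonup> real^'d"
  assumes "finite (dom f)" "N \<subseteq> dom f" "n - t \<le> card N" "n - t \<ge> 1"
  shows "average f N \<in> centroid_hyperbox n t f"
proof -
  have "finite N" "card N \<le> card (dom f)" using assms by (auto intro: finite_subset card_mono)
  then show ?thesis
    using assms mean_bounded_by_subsets[of N "n - t"]
    by (subst mem_centroid_hyperbox_iff) (simp_all add: average_nth, meson order_trans)
qed

lemma rb_tm_algorithm_mem:
  fixes f :: "nat \<rightharpoonup> real^'d"
  assumes fin: "finite (dom f)" and g: "n - t \<le> card (dom f)" "card (dom f) < 2 * (n - t)"
  shows "rb_tm_algorithm n t f \<in> centroid_hyperbox n t f \<inter> trimmed_trusted_hyperbox n t f"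
proof -
  let ?s = "card (dom f) - (n - t)" and ?xs = "sorted_list_of_set (dom f)"
  have xs: "distinct ?xs" "set ?xs = dom f" using fin by auto
  \<comment> \<open>The second part says that at least one value survives the trimming in each
    coordinate.\<close>
  have s: "?s + (n - t) = length ?xs" "?s < n - t" using g by auto
  note bounds = trimmed_mean_bounds[OF xs s refl refl]
  have rb: "rb_tm_algorithm n t f $ k =
      (\<Sum>j\<in>{?s+1..n-t}. sort (map (\<lambda>i. the (f i) $ k) ?xs) ! (j - 1)) / real (card {?s+1..n-t})" for k
    by (simp add: rb_tm_algorithm_def Let_def sorted_value_def)
  have "rb_tm_algorithm n t f \<in> centroid_hyperbox n t f"
    unfolding mem_centroid_hyperbox_iff[OF fin g(1)] rb using bounds(1,2) by blast
  moreover have "rb_tm_algorithm n t f \<in> trimmed_trusted_hyperbox n t f"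
    unfolding trimmed_trusted_hyperbox_def mem_box_cart rb
    using bounds(3,4) by (simp add: sorted_value_def)
  ultimately show ?thesis by blast
qed

lemma hyperbox_center_mem:
  fixes a b :: "real^'d"
  assumes "cbox a b \<noteq> {}"
  shows "hyperbox_center (cbox a b) \<in> cbox a b"
proof -
  have "{a, b} \<subseteq> cbox a b" using assms by (auto simp: box_ne_empty mem_box)
  then have "convex hull {a, b} \<subseteq> cbox a b" by (simp add: hull_minimal)
  then have "midpoint a b \<in> cbox a b"
    using midpoints_in_convex_hull[of a "{a, b}" b] by (auto simp: hull_inc)
  then show ?thesis using assms by (simp add: hyperbox_center_def)
qed

lemma box_algorithm_mem:
  fixes f :: "nat \<rightharpoonup> real^'d"
  assumes fin: "finite (dom f)" and g: "n - t \<le> card (dom f)" "card (dom f) < 2 * (n - t)"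
  shows "box_algorithm n t f \<in> centroid_hyperbox n t f"
proof -
  obtain p q where "centroid_hyperbox n t f = cbox p q"
    using centroid_hyperbox_cbox[OF fin g(1)] by blast
  then obtain a b where ab: "centroid_hyperbox n t f \<inter> trimmed_trusted_hyperbox n t f = cbox a b"
    by (simp add: trimmed_trusted_hyperbox_def Int_interval)
  then have "cbox a b \<noteq> {}" using rb_tm_algorithm_mem[OF assms] by auto
  then have "box_algorithm n t f \<in> cbox a b"
    unfolding box_algorithm_def ab by (rule hyperbox_center_mem)
  then show ?thesis using ab by blast
qed

theorem lemma3p9:
  fixes n t :: nat
  assumes "n \<ge> 1" and "n > 3 * t"
  shows "computes_approximation n t (2 * sqrt (real (min n CARD('d))))
           (box_algorithm n t :: (nat \<rightharpoonup> real^'d) \<Rightarrow> real^'d)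
       \<and> computes_approximation n t (2 * sqrt (real (min n CARD('d))))
           (rb_tm_algorithm n t :: (nat \<rightharpoonup> real^'d) \<Rightarrow> real^'d)"
proof -
  have approx: "computes_approximation n t (2 * sqrt (real (min n CARD('d)))) A"
    if mem: "\<And>f. finite (dom f) \<Longrightarrow> n - t \<le> card (dom f) \<Longrightarrow> card (dom f) < 2 * (n - t) \<Longrightarrow>
      A f \<in> centroid_hyperbox n t f" for A :: "(nat \<rightharpoonup> real^'d) \<Rightarrow> real^'d"
    unfolding computes_approximation_def
  proof (intro allI impI)
    fix f :: "nat \<rightharpoonup> real^'d" and N
    assume conf: "configuration n t f N"
    then have fin: "finite (dom f)" and card: "card (dom f) \<le> n"
      using finite_subset card_mono[of "{1..n}" "dom f"] by (auto simp: configuration_def)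
    show "dist (A f) (average f N) \<le>
        2 * sqrt (real (min n CARD('d))) * covering_radius (candidate_centroids n t f)"
      \<comment> \<open>From \<open>card (dom f) \<le> n\<close> and \<open>n > 3 * t\<close> come
        \<open>card (dom f) < 2 * (n - t)\<close> and \<open>n - t \<ge> 1\<close>, the numerical
        conditions of the lemmas applied here.\<close>
      using conf assms fin card unfolding configuration_def
      by (intro dist_centroid_hyperbox_le mem average_mem_centroid_hyperbox) auto
  qed
  show ?thesis
    using approx box_algorithm_mem rb_tm_algorithm_mem by blast
qed

end
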